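(* Let $\mathcal{H}$ be a $d$-dimensional complex Hilbert space ($d<\infty$), let $(\mathcal{V},\leq)$ be a partially ordered vector space, let $g:\mathcal{L}_s(\mathcal{H})\to\mathcal{V}$ be an order morphism, and let $G:\mathcal{O}_d\to\mathcal{V}$ be the associated map $G(\mathsf{A})=\sum_{x} g(\mathsf{A}_x)$. Then $G$ is order preserving on $\mathcal{O}_d$, i.e., $\mathsf{A}\preccurlyeq\mathsf{B}$ implies $G(\mathsf{A})\leq G(\mathsf{B})$ for all $\mathsf{A},\mathsf{B}\in\mathcal{O}_d$. Therefore $G$ respects the equivalence relation $\sim$ of quantum measurements (i.e. $\mathsf{A}\sim\mathsf{B}$ implies $G(\mathsf{A})=G(\mathsf{B})$) and it induces a map $G:\mathcal{O}_d^{\sim}\to\mathcal{V}$, $G([\mathsf{A}])=G(\mathsf{A})$. The induced map $G$ is order preserving on $\mathcal{O}_d^\sim$.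
   Context: $\mathcal{L}_s(\mathcal{H})$ is the real vector space of selfadjoint operators on $\mathcal{H}$. A measurement (POVM) $\mathsf{A}$ is a map $x\mapsto\mathsf{A}_x$ from a finite outcome set $\Omega_{\mathsf{A}}\subset\mathbb{Z}$ to operators on $\mathcal{H}$ with $\mathsf{A}_x\geq 0$ for all $x$ and $\sum_x\mathsf{A}_x=\mathbb{1}$; $\mathcal{O}_d$ is the set of all such measurements. Post-processing preorder: $\mathsf{A}\preccurlyeq\mathsf{B}$ if there is a matrix $(\mu_{xy})$ with nonnegative entries and $\sum_x\mu_{xy}=1$ for all $y$ such that $\mathsf{A}_x=\sum_y\mu_{xy}\mathsf{B}_y$ for all $x$. Write $\mathsf{A}\sim\mathsf{B}$ if $\mathsf{A}\preccurlyeq\mathsf{B}\preccurlyeq\mathsf{A}$; $[\mathsf{A}]$ is the equivalence class, $\mathcal{O}_d^\sim$ is the set of equivalence classes, partially ordered by $[\mathsf{A}]\preccurlyeq[\mathsf{B}]$ iff $\mathsf{A}\preccurlyeq\mathsf{B}$. A partially ordered vector space is a real vector space $\mathcal{V}$ with a partial order $\leq$ such that $x\leq y$ implies $x+z\leq y+z$ for all $z\in\mathcal V$ and $\lambda x\leq\lambda y$ for all real $\lambda\geq0$. An order morphism is a map $g:\mathcal{L}_s(\mathcal{H})\to\mathcal{V}$ such that (i) $g(\lambda E)=\lambda g(E)$ for all scalars $\lambda\geq0$, and (ii) $g(E+F)\leq g(E)+g(F)$, for all $E,F$. *)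

theory Defs
  imports Complex_Main
begin

class complex_vector = ab_group_add +
  fixes scaleC :: "complex \<Rightarrow> 'a \<Rightarrow> 'a" (infixr "*\<^sub>C" 75)
  assumes scaleC_add_right: "a *\<^sub>C (x + y) = a *\<^sub>C x + a *\<^sub>C y"
    and scaleC_add_left: "(a + b) *\<^sub>C x = a *\<^sub>C x + b *\<^sub>C x"
    and scaleC_scaleC: "a *\<^sub>C (b *\<^sub>C x) = (a * b) *\<^sub>C x"
    and scaleC_one: "1 *\<^sub>C x = x"

global_interpretation complex_vector:
  vector_space "scaleC :: complex \<Rightarrow> 'a \<Rightarrow> 'a::complex_vector"
  by unfold_locales (simp_all add: scaleC_add_right scaleC_add_left scaleC_scaleC scaleC_one)

text \<open>The inner product is linear in its second argument.\<close>

class complex_inner = complex_vector +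
  fixes cinner :: "'a \<Rightarrow> 'a \<Rightarrow> complex"
  assumes cinner_commute: "cinner x y = cnj (cinner y x)"
    and cinner_add_right: "cinner x (y + z) = cinner x y + cinner x z"
    and cinner_scaleC_right: "cinner x (a *\<^sub>C y) = a * cinner x y"
    and cinner_self_nonneg: "0 \<le> Re (cinner x x)"
    and cinner_self_eq_zero: "cinner x x = 0 \<Longrightarrow> x = 0"

text \<open>A finite-dimensional inner product space is automatically complete, so a type \<open>'h\<close> of class
  \<open>complex_inner\<close> satisfying the following predicate is a \<open>d\<close>-dimensional Hilbert space. The
  predicate is used instead of \<open>complex_vector.dim UNIV = d\<close> because \<open>dim\<close> is \<open>0\<close> on
  infinite-dimensional spaces.\<close>

definition has_dimension :: "'h::complex_inner itself \<Rightarrow> nat \<Rightarrow> bool" where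
  "has_dimension _ d \<longleftrightarrow> (\<exists>B :: 'h set.
     finite B \<and> card B = d \<and> complex_vector.independent B \<and> complex_vector.span B = UNIV)"

lemma cinner_add_left: "cinner (x + y) z = cinner x z + cinner y (z::'a::complex_inner)"
  by (metis cinner_commute cinner_add_right complex_cnj_add)

lemma cinner_scaleC_left: "cinner (a *\<^sub>C x) y = cnj a * cinner x (y::'a::complex_inner)"
  by (metis cinner_commute cinner_scaleC_right complex_cnj_mult)

lemma cinner_zero_right [simp]: "cinner x (0::'a::complex_inner) = 0"
  using cinner_add_right[of x 0 0] by simp

lemma cinner_zero_left [simp]: "cinner (0::'a::complex_inner) x = 0"
  using cinner_add_left[of 0 0 x] by simp

lemma cinner_minus_right: "cinner x (- y) = - cinner x (y::'a::complex_inner)"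
  using cinner_add_right[of x y "- y"] by (simp add: eq_neg_iff_add_eq_0 add.commute)

lemma cinner_minus_left: "cinner (- x) y = - cinner x (y::'a::complex_inner)"
  using cinner_add_left[of x "- x" y] by (simp add: eq_neg_iff_add_eq_0 add.commute)

lemma clinear_iff:
  fixes T :: "'a::complex_vector \<Rightarrow> 'b::complex_vector"
  shows "Vector_Spaces.linear scaleC scaleC T \<longleftrightarrow>
    (\<forall>x y. T (x + y) = T x + T y) \<and> (\<forall>a x. T (a *\<^sub>C x) = a *\<^sub>C T x)"
  by (auto simp: Vector_Spaces.linear_def module_hom_def module_hom_axioms_def
      complex_vector.vector_space_axioms complex_vector.module_axioms)

typedef (overloaded) 'h selfadjoint =
  "{T :: 'h::complex_inner \<Rightarrow> 'h.
      Vector_Spaces.linear scaleC scaleC T \<and> (\<forall>x y. cinner (T x) y = cinner x (T y))}"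
  morphisms apply_op selfadjoint_of
  by (rule exI[of _ "\<lambda>x. 0"]) (simp add: clinear_iff complex_vector.scale_zero_right)

setup_lifting type_definition_selfadjoint

instantiation selfadjoint :: (complex_inner) real_vector
begin

lift_definition zero_selfadjoint :: "'a selfadjoint" is "\<lambda>x. 0"
  by (simp add: clinear_iff complex_vector.scale_zero_right)

lift_definition plus_selfadjoint :: "'a selfadjoint \<Rightarrow> 'a selfadjoint \<Rightarrow> 'a selfadjoint"
  is "\<lambda>S T x. S x + T x"
  by (simp add: clinear_iff scaleC_add_right cinner_add_left cinner_add_right algebra_simps)

lift_definition uminus_selfadjoint :: "'a selfadjoint \<Rightarrow> 'a selfadjoint" is "\<lambda>T x. - T x"
  by (simp add: clinear_iff complex_vector.scale_minus_right cinner_minus_left cinner_minus_right)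

definition minus_selfadjoint :: "'a selfadjoint \<Rightarrow> 'a selfadjoint \<Rightarrow> 'a selfadjoint" where
  "S - T = S + - (T :: 'a selfadjoint)"

lift_definition scaleR_selfadjoint :: "real \<Rightarrow> 'a selfadjoint \<Rightarrow> 'a selfadjoint"
  is "\<lambda>r T x. complex_of_real r *\<^sub>C T x"
  by (simp add: clinear_iff scaleC_add_right scaleC_scaleC mult.commute
      cinner_scaleC_left cinner_scaleC_right)

instance
proof
  fix a b c :: "'a selfadjoint" and r s :: real
  show "a + b + c = a + (b + c)" by transfer (simp add: add.assoc)
  show "a + b = b + a" by transfer (simp add: add.commute)
  show "0 + a = a" by transfer simp
  show "- a + a = 0" by transfer simp
  show "a - b = a + - b" by (rule minus_selfadjoint_def)
  show "r *\<^sub>R (a + b) = r *\<^sub>R a + r *\<^sub>R b" by transfer (simp add: scaleC_add_right)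
  show "(r + s) *\<^sub>R a = r *\<^sub>R a + s *\<^sub>R a" by transfer (simp add: scaleC_add_left)
  show "r *\<^sub>R s *\<^sub>R a = (r * s) *\<^sub>R a" by transfer (simp add: scaleC_scaleC)
  show "1 *\<^sub>R a = a" by transfer (simp add: scaleC_one)
qed

end

lift_definition identity_op :: "'h::complex_inner selfadjoint" is "\<lambda>x. x"
  by (simp add: clinear_iff)

text \<open>For selfadjoint \<open>E\<close> the number \<open>cinner x (E x)\<close> is real.\<close>

definition positive_op :: "'h::complex_inner selfadjoint \<Rightarrow> bool" where
  "positive_op E \<longleftrightarrow> (\<forall>x. 0 \<le> Re (cinner x (apply_op E x)))"

text \<open>A measurement is a partial map on the integers whose domain is the outcome set, so the
  outcome set is part of the measurement. Positive operators on a complex Hilbert space are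
  selfadjoint, so no generality is lost by taking values in \<open>'h selfadjoint\<close>.\<close>

typedef (overloaded) 'h measurement =
  "{A :: int \<rightharpoonup> 'h::complex_inner selfadjoint.
      finite (dom A) \<and> (\<forall>x\<in>dom A. positive_op (the (A x))) \<and>
      (\<Sum>x\<in>dom A. the (A x)) = identity_op}"
  by (rule exI[of _ "[0 \<mapsto> identity_op]"])
    (simp add: positive_op_def identity_op.rep_eq cinner_self_nonneg)

definition outcomes :: "'h::complex_inner measurement \<Rightarrow> int set" where
  "outcomes A = dom (Rep_measurement A)"

definition effect :: "'h::complex_inner measurement \<Rightarrow> int \<Rightarrow> 'h selfadjoint" where
  "effect A x = the (Rep_measurement A x)"

definition post_processing ::
    "'h::complex_inner measurement \<Rightarrow> 'h measurement \<Rightarrow> bool" (infix "\<preceq>" 50) where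
  "A \<preceq> B \<longleftrightarrow> (\<exists>\<mu> :: int \<Rightarrow> int \<Rightarrow> real.
     (\<forall>x\<in>outcomes A. \<forall>y\<in>outcomes B. 0 \<le> \<mu> x y) \<and>
     (\<forall>y\<in>outcomes B. (\<Sum>x\<in>outcomes A. \<mu> x y) = 1) \<and>
     (\<forall>x\<in>outcomes A. effect A x = (\<Sum>y\<in>outcomes B. \<mu> x y *\<^sub>R effect B y)))"

definition post_equiv ::
    "'h::complex_inner measurement \<Rightarrow> 'h measurement \<Rightarrow> bool" (infix "\<sim>" 50) where
  "A \<sim> B \<longleftrightarrow> A \<preceq> B \<and> B \<preceq> A"

lemma finite_outcomes: "finite (outcomes A)"
  using Rep_measurement[of A] by (simp add: outcomes_def)

lemma post_processing_refl: "A \<preceq> A"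
  unfolding post_processing_def
proof (intro exI conjI ballI)
  fix x y assume "x \<in> outcomes A"
  show "0 \<le> (if x = y then 1 else 0 :: real)" by simp
next
  fix y assume "y \<in> outcomes A"
  then show "(\<Sum>x\<in>outcomes A. if x = y then 1 else 0 :: real) = 1"
    by (simp add: finite_outcomes)
next
  fix x assume x: "x \<in> outcomes A"
  have "(\<Sum>y\<in>outcomes A. (if x = y then 1 else 0 :: real) *\<^sub>R effect A y)
      = (\<Sum>y\<in>outcomes A. if x = y then effect A y else 0)"
    by (rule sum.cong) auto
  also have "\<dots> = effect A x" using x by (simp add: finite_outcomes)
  finally show "effect A x =
      (\<Sum>y\<in>outcomes A. (if x = y then 1 else 0 :: real) *\<^sub>R effect A y)" by simp
qed

lemma post_processing_trans:
  assumes "A \<preceq> B" and "B \<preceq> C"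
  shows "A \<preceq> C"
proof -
  obtain \<mu> :: "int \<Rightarrow> int \<Rightarrow> real" where
    m1: "\<forall>x\<in>outcomes A. \<forall>y\<in>outcomes B. 0 \<le> \<mu> x y" and
    m2: "\<forall>y\<in>outcomes B. (\<Sum>x\<in>outcomes A. \<mu> x y) = 1" and
    m3: "\<forall>x\<in>outcomes A. effect A x = (\<Sum>y\<in>outcomes B. \<mu> x y *\<^sub>R effect B y)"
    using assms(1) unfolding post_processing_def by blast
  obtain \<nu> :: "int \<Rightarrow> int \<Rightarrow> real" where
    n1: "\<forall>x\<in>outcomes B. \<forall>y\<in>outcomes C. 0 \<le> \<nu> x y" and
    n2: "\<forall>y\<in>outcomes C. (\<Sum>x\<in>outcomes B. \<nu> x y) = 1" and
    n3: "\<forall>x\<in>outcomes B. effect B x = (\<Sum>y\<in>outcomes C. \<nu> x y *\<^sub>R effect C y)"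
    using assms(2) unfolding post_processing_def by blast
  define \<kappa> where "\<kappa> x z = (\<Sum>y\<in>outcomes B. \<mu> x y * \<nu> y z)" for x z
  show ?thesis
    unfolding post_processing_def
  proof (intro exI conjI ballI)
    fix x z assume "x \<in> outcomes A" "z \<in> outcomes C"
    then show "0 \<le> \<kappa> x z"
      unfolding \<kappa>_def using m1 n1 by (intro sum_nonneg mult_nonneg_nonneg) auto
  next
    fix z assume z: "z \<in> outcomes C"
    have "(\<Sum>x\<in>outcomes A. \<kappa> x z) = (\<Sum>y\<in>outcomes B. (\<Sum>x\<in>outcomes A. \<mu> x y) * \<nu> y z)"
      unfolding \<kappa>_def by (subst sum.swap) (simp add: sum_distrib_right)
    also have "\<dots> = 1" using m2 n2 z by simp
    finally show "(\<Sum>x\<in>outcomes A. \<kappa> x z) = 1" .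
  next
    fix x assume x: "x \<in> outcomes A"
    have "effect A x = (\<Sum>y\<in>outcomes B. \<mu> x y *\<^sub>R (\<Sum>z\<in>outcomes C. \<nu> y z *\<^sub>R effect C z))"
      using m3 n3 x by simp
    also have "\<dots> = (\<Sum>y\<in>outcomes B. \<Sum>z\<in>outcomes C. (\<mu> x y * \<nu> y z) *\<^sub>R effect C z)"
      by (simp add: scaleR_sum_right)
    also have "\<dots> = (\<Sum>z\<in>outcomes C. \<kappa> x z *\<^sub>R effect C z)"
      unfolding \<kappa>_def by (subst sum.swap) (simp add: scaleR_sum_left)
    finally show "effect A x = (\<Sum>z\<in>outcomes C. \<kappa> x z *\<^sub>R effect C z)" .
  qed
qed

lemma equivp_post_equiv: "equivp post_equiv"
  by (rule equivpI)
    (auto simp: reflp_def symp_def transp_def post_equiv_def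
      intro: post_processing_refl post_processing_trans)

quotient_type (overloaded) 'h measurement_class = "'h::complex_inner measurement" / post_equiv
  morphisms rep_measurement_class class_of
  by (rule equivp_post_equiv)

instantiation measurement_class :: (complex_inner) order
begin

lift_definition less_eq_measurement_class ::
    "'a measurement_class \<Rightarrow> 'a measurement_class \<Rightarrow> bool" is post_processing
  by (auto simp: post_equiv_def intro: post_processing_trans)

definition less_measurement_class ::
    "'a measurement_class \<Rightarrow> 'a measurement_class \<Rightarrow> bool" where
  "X < Y \<longleftrightarrow> X \<le> Y \<and> \<not> Y \<le> (X :: 'a measurement_class)"

instance
proof
  fix X Y Z :: "'a measurement_class"
  show "X < Y \<longleftrightarrow> X \<le> Y \<and> \<not> Y \<le> X" by (rule less_measurement_class_def)
  show "X \<le> X" by transfer (rule post_processing_refl)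
  show "X \<le> Y \<Longrightarrow> Y \<le> Z \<Longrightarrow> X \<le> Z" by transfer (rule post_processing_trans)
  show "X \<le> Y \<Longrightarrow> Y \<le> X \<Longrightarrow> X = Y" by transfer (simp add: post_equiv_def)
qed

end

lemma class_of_le_iff: "class_of A \<le> class_of B \<longleftrightarrow> A \<preceq> B"
  by (rule less_eq_measurement_class.abs_eq)

text \<open>The class \<open>ordered_real_vector\<close> captures partially ordered vector spaces: its axiom
  \<open>scaleR_right_mono\<close> follows from the other ones.\<close>

definition order_morphism ::
    "('h::complex_inner selfadjoint \<Rightarrow> 'v::ordered_real_vector) \<Rightarrow> bool" where
  "order_morphism g \<longleftrightarrow>
     (\<forall>c\<ge>0. \<forall>E. g (c *\<^sub>R E) = c *\<^sub>R g E) \<and> (\<forall>E F. g (E + F) \<le> g E + g F)"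

definition associated_map ::
    "('h::complex_inner selfadjoint \<Rightarrow> 'v::ordered_real_vector) \<Rightarrow> 'h measurement \<Rightarrow> 'v" where
  "associated_map g A = (\<Sum>x\<in>outcomes A. g (effect A x))"

end

theory Submission imports Defs begin

text \<open>Sublinearity bounds each \<open>g (effect A x)\<close> by \<open>\<Sum>y. \<mu> x y *\<^sub>R g (effect B y)\<close>; summing over
  \<open>x\<close> removes \<open>\<mu>\<close>, because its columns sum to \<open>1\<close>. Monotonicity and antisymmetry of the order on
  \<open>'v\<close> then let the map descend to the quotient.\<close>

lemma order_morphism_scaleR:
  "order_morphism g \<Longrightarrow> 0 \<le> c \<Longrightarrow> g (c *\<^sub>R E) = c *\<^sub>R g E"
  by (simp add: order_morphism_def)

lemma order_morphism_add: "order_morphism g \<Longrightarrow> g (E + F) \<le> g E + g F"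
  by (simp add: order_morphism_def)

text \<open>Homogeneity with factor \<open>0\<close> gives this; subadditivity alone yields only
  \<open>0 \<le> g 0\<close>. It settles the sums without terms.\<close>

lemma order_morphism_zero: "order_morphism g \<Longrightarrow> g 0 = 0"
  using order_morphism_scaleR[of g 0 0] by simp

text \<open>Subadditivity is iterated by induction on \<open>I\<close>. For empty or infinite
  \<open>I\<close> both sums are \<open>0\<close>, so the claim reduces to
  \<open>g 0 = 0\<close>.\<close>

lemma order_morphism_sum:
  assumes "order_morphism g"
  shows "g (\<Sum>i\<in>I. E i) \<le> (\<Sum>i\<in>I. g (E i))"
proof (induction I rule: infinite_finite_induct)
  case (insert i I)
  have "g (E i + (\<Sum>i\<in>I. E i)) \<le> g (E i) + g (\<Sum>i\<in>I. E i)"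
    by (rule order_morphism_add[OF assms])
  also have "\<dots> \<le> g (E i) + (\<Sum>i\<in>I. g (E i))"
    using insert.IH by (rule add_left_mono)
  finally show ?case using insert.hyps by simp
qed (simp_all add: order_morphism_zero[OF assms])

lemma associated_map_mono:
  assumes g: "order_morphism g" and "A \<preceq> B"
  shows "associated_map g A \<le> associated_map g B"
proof -
  obtain \<mu> :: "int \<Rightarrow> int \<Rightarrow> real" where
    nonneg: "\<And>x y. x \<in> outcomes A \<Longrightarrow> y \<in> outcomes B \<Longrightarrow> 0 \<le> \<mu> x y" and
    stochastic: "\<And>y. y \<in> outcomes B \<Longrightarrow> (\<Sum>x\<in>outcomes A. \<mu> x y) = 1" and
    eff: "\<And>x. x \<in> outcomes A \<Longrightarrow> effect A x = (\<Sum>y\<in>outcomes B. \<mu> x y *\<^sub>R effect B y)"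
    using \<open>A \<preceq> B\<close> unfolding post_processing_def by blast
  have "associated_map g A = (\<Sum>x\<in>outcomes A. g (\<Sum>y\<in>outcomes B. \<mu> x y *\<^sub>R effect B y))"
    by (simp add: associated_map_def eff)
  also have "\<dots> \<le> (\<Sum>x\<in>outcomes A. \<Sum>y\<in>outcomes B. g (\<mu> x y *\<^sub>R effect B y))"
    by (intro sum_mono order_morphism_sum[OF g])
  \<comment> \<open>Homogeneity covers only nonnegative scalars, so this is where the signs of the
    entries of \<open>\<mu>\<close> enter.\<close>
  also have "\<dots> = (\<Sum>x\<in>outcomes A. \<Sum>y\<in>outcomes B. \<mu> x y *\<^sub>R g (effect B y))"
    by (intro sum.cong refl order_morphism_scaleR[OF g] nonneg)
  also have "\<dots> = (\<Sum>y\<in>outcomes B. (\<Sum>x\<in>outcomes A. \<mu> x y) *\<^sub>R g (effect B y))"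
    by (subst sum.swap) (simp add: scaleR_sum_left)
  also have "\<dots> = associated_map g B"
    by (simp add: associated_map_def stochastic)
  finally show ?thesis .
qed

theorem proposition4p3:
  fixes d :: nat
    and g :: "'h::complex_inner selfadjoint \<Rightarrow> 'v::ordered_real_vector"
    and G :: "'h measurement \<Rightarrow> 'v"
  assumes "has_dimension TYPE('h) d"
    and "order_morphism g"
    and "G = associated_map g"
  shows "(\<forall>A B. A \<preceq> B \<longrightarrow> G A \<le> G B)
    \<and> (\<forall>A B. A \<sim> B \<longrightarrow> G A = G B)
    \<and> (\<exists>!G' :: 'h measurement_class \<Rightarrow> 'v. \<forall>A. G' (class_of A) = G A)
    \<and> (\<forall>G' :: 'h measurement_class \<Rightarrow> 'v. (\<forall>A. G' (class_of A) = G A) \<longrightarrow>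
         (\<forall>X Y. X \<le> Y \<longrightarrow> G' X \<le> G' Y))"
proof (intro conjI)
  have mono: "G A \<le> G B" if "A \<preceq> B" for A B
    using associated_map_mono[OF assms(2) that] assms(3) by simp
  have resp: "G A = G B" if "A \<sim> B" for A B
    using that by (auto simp: post_equiv_def intro: antisym mono)
  show "\<forall>A B. A \<preceq> B \<longrightarrow> G A \<le> G B" using mono by blast
  show "\<forall>A B. A \<sim> B \<longrightarrow> G A = G B" using resp by blast
  show "\<exists>!G' :: 'h measurement_class \<Rightarrow> 'v. \<forall>A. G' (class_of A) = G A"
  proof (rule ex1I)
    \<comment> \<open>The witness evaluates \<open>G\<close> at a chosen representative of each
      class. That representative of \<open>class_of A\<close> may differ from \<open>A\<close>, but
      it is equivalent to \<open>A\<close>, so \<open>resp\<close> gives the same value.\<close>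
    have "rep_measurement_class (class_of A) \<sim> A" for A :: "'h measurement"
      by (rule rep_abs_rsp_left[OF Quotient3_measurement_class])
        (rule equivp_reflp[OF equivp_post_equiv])
    then show "\<forall>A. (G \<circ> rep_measurement_class) (class_of A) = G A"
      by (simp add: resp)
  next
    fix G' :: "'h measurement_class \<Rightarrow> 'v"
    assume G': "\<forall>A. G' (class_of A) = G A"
    show "G' = G \<circ> rep_measurement_class"
    proof
      fix X :: "'h measurement_class"
      \<comment> \<open>Uniqueness: \<open>class_of\<close> is surjective, so the values of
        \<open>G'\<close> on its range determine \<open>G'\<close>.\<close>
      have "class_of (rep_measurement_class X) = X"
        by (rule Quotient3_abs_rep[OF Quotient3_measurement_class])
      then show "G' X = (G \<circ> rep_measurement_class) X"
        using G' by (metis comp_apply)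
    qed
  qed
  show "\<forall>G' :: 'h measurement_class \<Rightarrow> 'v. (\<forall>A. G' (class_of A) = G A) \<longrightarrow>
      (\<forall>X Y. X \<le> Y \<longrightarrow> G' X \<le> G' Y)"
  proof (intro allI impI)
    fix G' :: "'h measurement_class \<Rightarrow> 'v" and X Y :: "'h measurement_class"
    assume "\<forall>A. G' (class_of A) = G A" and "X \<le> Y"
    \<comment> \<open>With \<open>X\<close> and \<open>Y\<close> written as classes of measurements,
      the order on classes becomes post-processing and \<open>G'\<close> becomes \<open>G\<close>,
      so \<open>mono\<close> applies.\<close>
    then show "G' X \<le> G' Y"
      by (induction X rule: measurement_class.abs_induct,
          induction Y rule: measurement_class.abs_induct) (simp add: class_of_le_iff mono)
  qed
qed

end
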